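(* Let $\mathbb F$ be a field of characteristic $0$. For any $m>n$ there are depth-3 fMC refutations over $\mathbb F$ of the $m$ to $n$ pigeonhole principle $\neg\mathrm{PHP}^m_n$ of size polynomial in $n$.
   Context: $\neg\mathrm{PHP}^m_n$ has variables $x_{i,j}$ ($i\in[m]$, $j\in[n]$) and consists of the disjunctions $(x_{i,1}=1)\vee\dots\vee(x_{i,n}=1)$ ($i\in[m]$) and $(x_{i,k}=0)\vee(x_{j,k}=0)$ ($1\le i<j\le m$, $k\in[n]$). A disjunction of linear equations $D=\bigvee_{j=1}^t(\vec a^{(j)}\cdot\vec x=a^{(j)}_0)$ is translated to the polynomial $\widehat D=\prod_{j=1}^t(\vec a^{(j)}\cdot\vec x-a^{(j)}_0)$; an fMC refutation of $\neg\mathrm{PHP}^m_n$ is an fMC refutation of the translated polynomials. Arithmetic formula over $\mathbb F$: a tree with unbounded fan-in, leaves labeled by variables or field elements, edges possibly labeled by field elements, internal nodes $+$ or $\times$; size = number of nodes; depth = longest leaf-to-root path (edges). Multilinear formula: every gate computes a multilinear polynomial. fMC: variables $x_i,\bar x_i$; Boolean axioms $x_i+\bar x_i-1$, $x_i\bar x_i$; a proof from $Q$ is a sequence of multilinear polynomials each in $Q$, a Boolean axiom, or derived by Product (from $p$ derive $qp$ for any polynomial $q$ with $qp$ multilinear) or Addition (from $p,q$ derive $\alpha p+\beta q$); polynomials are represented by multilinear formulas, size = total formula size; a refutation derives $1$. Depth-3 fMC: all formulas have depth at most 3. *)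

theory Defs
  imports
    Complex_Main
    "HOL-Library.Poly_Mapping"
    "HOL-Computational_Algebra.Polynomial"
begin

type_synonym ('x, 'a) mpoly = "('x \<Rightarrow>\<^sub>0 nat) \<Rightarrow>\<^sub>0 'a"

definition mconst :: "'a \<Rightarrow> ('x, 'a::zero) mpoly" where
  "mconst c = Poly_Mapping.single 0 c"

definition mvar :: "'x \<Rightarrow> ('x, 'a::zero_neq_one) mpoly" where
  "mvar x = Poly_Mapping.single (Poly_Mapping.single x 1) 1"

definition mpoly_vars :: "('x, 'a::zero) mpoly \<Rightarrow> 'x set" where
  "mpoly_vars p = (\<Union>t\<in>Poly_Mapping.keys p. Poly_Mapping.keys t)"

definition multilinear :: "('x, 'a::zero) mpoly \<Rightarrow> bool" where
  "multilinear p \<longleftrightarrow> (\<forall>t\<in>Poly_Mapping.keys p. \<forall>x. Poly_Mapping.lookup t x \<le> 1)"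

text \<open>A gate carries the list of its children, each with the field element labelling the edge
  to it; an unlabelled edge is an edge labelled by 1, which computes the same polynomial.\<close>

datatype ('x, 'a) aformula =
    VarLeaf 'x
  | ConstLeaf 'a
  | PlusGate "('a \<times> ('x, 'a) aformula) list"
  | TimesGate "('a \<times> ('x, 'a) aformula) list"

fun computes :: "('x, 'a::comm_ring_1) aformula \<Rightarrow> ('x, 'a) mpoly" where
  "computes (VarLeaf x) = mvar x"
| "computes (ConstLeaf c) = mconst c"
| "computes (PlusGate es) = sum_list (map (\<lambda>(c, f). mconst c * computes f) es)"
| "computes (TimesGate es) = prod_list (map (\<lambda>(c, f). mconst c * computes f) es)"

text \<open>In a tree every node without children is a leaf, so gates have at least one child.\<close>

fun proper_formula :: "('x, 'a) aformula \<Rightarrow> bool" where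
  "proper_formula (VarLeaf x) \<longleftrightarrow> True"
| "proper_formula (ConstLeaf c) \<longleftrightarrow> True"
| "proper_formula (PlusGate es) \<longleftrightarrow> es \<noteq> [] \<and> (\<forall>(c, f)\<in>set es. proper_formula f)"
| "proper_formula (TimesGate es) \<longleftrightarrow> es \<noteq> [] \<and> (\<forall>(c, f)\<in>set es. proper_formula f)"

fun formula_vars :: "('x, 'a) aformula \<Rightarrow> 'x set" where
  "formula_vars (VarLeaf x) = {x}"
| "formula_vars (ConstLeaf c) = {}"
| "formula_vars (PlusGate es) = (\<Union>(c, f)\<in>set es. formula_vars f)"
| "formula_vars (TimesGate es) = (\<Union>(c, f)\<in>set es. formula_vars f)"

fun formula_size :: "('x, 'a) aformula \<Rightarrow> nat" where
  "formula_size (VarLeaf x) = 1"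
| "formula_size (ConstLeaf c) = 1"
| "formula_size (PlusGate es) = 1 + sum_list (map (\<lambda>(c, f). formula_size f) es)"
| "formula_size (TimesGate es) = 1 + sum_list (map (\<lambda>(c, f). formula_size f) es)"

fun formula_depth :: "('x, 'a) aformula \<Rightarrow> nat" where
  "formula_depth (VarLeaf x) = 0"
| "formula_depth (ConstLeaf c) = 0"
| "formula_depth (PlusGate es) = 1 + Max (set (map (\<lambda>(c, f). formula_depth f) es))"
| "formula_depth (TimesGate es) = 1 + Max (set (map (\<lambda>(c, f). formula_depth f) es))"

fun multilinear_formula :: "('x, 'a::comm_ring_1) aformula \<Rightarrow> bool" where
  "multilinear_formula (VarLeaf x) \<longleftrightarrow> multilinear (computes (VarLeaf x :: ('x, 'a) aformula))"
| "multilinear_formula (ConstLeaf c) \<longleftrightarrow> multilinear (computes (ConstLeaf c :: ('x, 'a) aformula))"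
| "multilinear_formula (PlusGate es) \<longleftrightarrow>
     multilinear (computes (PlusGate es)) \<and> (\<forall>(c, f)\<in>set es. multilinear_formula f)"
| "multilinear_formula (TimesGate es) \<longleftrightarrow>
     multilinear (computes (TimesGate es)) \<and> (\<forall>(c, f)\<in>set es. multilinear_formula f)"

text \<open>\<open>Pos v\<close> is the variable \<open>x\<^sub>v\<close>, and \<open>Neg v\<close> is the independent formal variable
  written \<open>x\<^sub>v\<close> with a bar.\<close>

datatype 'v fmc_var = Pos 'v | Neg 'v

definition fmc_vars :: "'v set \<Rightarrow> 'v fmc_var set" where
  "fmc_vars V = Pos ` V \<union> Neg ` V"

definition boolean_axioms :: "'v set \<Rightarrow> ('v fmc_var, 'a::comm_ring_1) mpoly set" where
  "boolean_axioms V =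
     {mvar (Pos v) + mvar (Neg v) - 1 | v. v \<in> V} \<union> {mvar (Pos v) * mvar (Neg v) | v. v \<in> V}"

text \<open>\<open>fmc_step V Q S p\<close>: the polynomial \<open>p\<close> is an axiom or is obtained by one rule application
  from the set \<open>S\<close> of polynomials already derived. Multilinearity of \<open>p\<close> (in particular the side
  condition of the product rule) is imposed on every line in \<open>fmc_proof\<close>.\<close>

definition fmc_step ::
  "'v set \<Rightarrow> ('v fmc_var, 'a::comm_ring_1) mpoly set \<Rightarrow> ('v fmc_var, 'a) mpoly set \<Rightarrow>
   ('v fmc_var, 'a) mpoly \<Rightarrow> bool" where
  "fmc_step V Q S p \<longleftrightarrow>
     p \<in> Q \<or>
     p \<in> boolean_axioms V \<or>
     (\<exists>r\<in>S. \<exists>q. mpoly_vars q \<subseteq> fmc_vars V \<and> p = q * r) \<or>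
     (\<exists>r\<in>S. \<exists>s\<in>S. \<exists>\<alpha> \<beta>. p = mconst \<alpha> * r + mconst \<beta> * s)"

text \<open>A proof is presented as the list of the formulas representing its lines.\<close>

definition fmc_proof ::
  "'v set \<Rightarrow> ('v fmc_var, 'a::comm_ring_1) mpoly set \<Rightarrow> ('v fmc_var, 'a) aformula list \<Rightarrow>
   ('v fmc_var, 'a) mpoly \<Rightarrow> bool" where
  "fmc_proof V Q \<pi> P \<longleftrightarrow>
     \<pi> \<noteq> [] \<and> computes (last \<pi>) = P \<and>
     (\<forall>i < length \<pi>.
        proper_formula (\<pi> ! i) \<and>
        formula_vars (\<pi> ! i) \<subseteq> fmc_vars V \<and>
        multilinear_formula (\<pi> ! i) \<and>
        multilinear (computes (\<pi> ! i)) \<and>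
        fmc_step V Q {computes (\<pi> ! j) | j. j < i} (computes (\<pi> ! i)))"

definition fmc_refutation ::
  "'v set \<Rightarrow> ('v fmc_var, 'a::comm_ring_1) mpoly set \<Rightarrow> ('v fmc_var, 'a) aformula list \<Rightarrow> bool" where
  "fmc_refutation V Q \<pi> \<longleftrightarrow> fmc_proof V Q \<pi> 1"

definition fmc_size :: "('x, 'a) aformula list \<Rightarrow> nat" where
  "fmc_size \<pi> = sum_list (map formula_size \<pi>)"

definition fmc_depth_at_most :: "nat \<Rightarrow> ('x, 'a) aformula list \<Rightarrow> bool" where
  "fmc_depth_at_most d \<pi> \<longleftrightarrow> (\<forall>f\<in>set \<pi>. formula_depth f \<le> d)"

text \<open>The pair \<open>(a, b)\<close> stands for the linear equation \<open>\<Sum>v. a v * x\<^sub>v = b\<close>, with finitely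
  supported coefficient vector \<open>a\<close>; a list of pairs stands for their disjunction.\<close>

type_synonym ('v, 'a) lin_eq = "('v \<Rightarrow>\<^sub>0 'a) \<times> 'a"
type_synonym ('v, 'a) lin_disj = "('v, 'a) lin_eq list"

definition lin_eq_poly :: "('v, 'a::comm_ring_1) lin_eq \<Rightarrow> ('v fmc_var, 'a) mpoly" where
  "lin_eq_poly e =
     (\<Sum>v\<in>Poly_Mapping.keys (fst e). mconst (Poly_Mapping.lookup (fst e) v) * mvar (Pos v))
     - mconst (snd e)"

definition translate :: "('v, 'a::comm_ring_1) lin_disj \<Rightarrow> ('v fmc_var, 'a) mpoly" where
  "translate D = prod_list (map lin_eq_poly D)"

definition var_eq :: "'v \<Rightarrow> 'a \<Rightarrow> ('v, 'a::comm_ring_1) lin_eq" where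
  "var_eq v b = (Poly_Mapping.single v 1, b)"

definition php_vars :: "nat \<Rightarrow> nat \<Rightarrow> (nat \<times> nat) set" where
  "php_vars m n = {1..m} \<times> {1..n}"

definition neg_PHP :: "nat \<Rightarrow> nat \<Rightarrow> (nat \<times> nat, 'a::comm_ring_1) lin_disj set" where
  "neg_PHP m n =
     {map (\<lambda>j. var_eq (i, j) 1) [1..<Suc n] | i. i \<in> {1..m}} \<union>
     {[var_eq (i, k) 0, var_eq (j, k) 0] | i j k. 1 \<le> i \<and> i < j \<and> j \<le> m \<and> k \<in> {1..n}}"

end

theory Submission
  imports Defs "HOL-Library.Disjoint_Sets"
begin

text \<open>Only the first \<open>n + 1\<close> pigeons are used. For a set \<open>U\<close> of variables let \<open>E\<^sub>t(U)\<close> be the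
  coefficient of \<open>z\<^sup>t\<close> in \<open>\<Prod>\<^sub>v (1 - x\<^sub>v + z x\<^sub>v)\<close>, the multilinear polynomial that is \<open>1\<close> on the Boolean
  points of weight \<open>t\<close> and \<open>0\<close> on the others. Interpolation at \<open>|U| + 1\<close> values of \<open>z\<close> (this is where
  characteristic \<open>0\<close> enters) makes it a short sum of products of linear forms, and
  \<open>E\<^sub>t(U \<union> U') = \<Sum>\<^sub>a E\<^sub>a(U) E\<^sub>t\<^sub>-\<^sub>a(U')\<close> for disjoint \<open>U\<close>, \<open>U'\<close>. The hole axioms give \<open>E\<^sub>t = 0\<close> for
  \<open>t \<ge> 2\<close> on each hole, and adding one hole at a time \<open>E\<^sub>t = 0\<close> for \<open>t > n\<close> on all variables. The
  axiom of a pigeon is \<open>\<plusminus>E\<^sub>0\<close> on its variables, so adding one pigeon at a time gives \<open>E\<^sub>t = 0\<close> for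
  \<open>t \<le> n\<close> on all variables. The sum of all the \<open>E\<^sub>t\<close> is identically \<open>1\<close>.\<close>

section \<open>Multilinear polynomials\<close>

lemma mconst_0 [simp]: "mconst 0 = 0"
  by (simp add: mconst_def)

lemma mconst_1 [simp]: "mconst 1 = 1"
  by (simp add: mconst_def)

lemma mconst_add: "mconst (a + b) = mconst a + mconst b"
  by (simp add: mconst_def single_add)

lemma mconst_mult: "mconst (a * b) = mconst a * mconst b"
  by (simp add: mconst_def mult_single)

lemma mconst_minus: "mconst (- a) = - mconst a"
  by (simp add: mconst_def single_uminus)

lemma mconst_diff: "mconst (a - b) = mconst a - mconst b"
  by (simp add: mconst_def single_diff)

lemma mconst_power: "mconst (a ^ n) = mconst a ^ n"
  by (induction n) (simp_all add: mconst_mult)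

lemma mconst_sum: "mconst (sum f A) = (\<Sum>i\<in>A. mconst (f i))"
  by (induction A rule: infinite_finite_induct) (simp_all add: mconst_add)

lemma mpoly_vars_0 [simp]: "mpoly_vars 0 = {}"
  by (simp add: mpoly_vars_def)

lemma mpoly_vars_mconst [simp]: "mpoly_vars (mconst c) = {}"
  by (simp add: mpoly_vars_def mconst_def)

lemma mpoly_vars_mvar: "mpoly_vars (mvar x) \<subseteq> {x}"
  by (auto simp: mpoly_vars_def mvar_def split: if_splits)

lemma mpoly_vars_add: "mpoly_vars (p + q) \<subseteq> mpoly_vars p \<union> mpoly_vars q"
  using keys_add[of p q] by (auto simp: mpoly_vars_def)

lemma mpoly_vars_mult: "mpoly_vars (p * q) \<subseteq> mpoly_vars p \<union> mpoly_vars q"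
proof
  fix x assume "x \<in> mpoly_vars (p * q)"
  then obtain t where t: "t \<in> Poly_Mapping.keys (p * q)" "x \<in> Poly_Mapping.keys t"
    by (auto simp: mpoly_vars_def)
  then obtain a b where "a \<in> Poly_Mapping.keys p" "b \<in> Poly_Mapping.keys q" "t = a + b"
    using keys_mult[of p q] by blast
  with t keys_add[of a b] show "x \<in> mpoly_vars p \<union> mpoly_vars q"
    by (auto simp: mpoly_vars_def)
qed

lemma multilinear_0 [simp]: "multilinear 0"
  by (simp add: multilinear_def)

lemma multilinear_mconst [simp]: "multilinear (mconst c)"
  by (simp add: multilinear_def mconst_def)

lemma multilinear_1 [simp]: "multilinear 1"
  by (metis mconst_1 multilinear_mconst)

lemma multilinear_mvar [simp]: "multilinear (mvar x)"
  by (auto simp: multilinear_def mvar_def lookup_single when_def split: if_splits)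

lemma multilinear_add: "multilinear p \<Longrightarrow> multilinear q \<Longrightarrow> multilinear (p + q)"
  using keys_add[of p q] by (auto simp: multilinear_def)

text \<open>In a product of a monomial of \<open>p\<close> and a monomial of \<open>q\<close>,
  disjointness leaves the exponent of each variable to one of the two factors.\<close>

lemma multilinear_mult:
  assumes "multilinear p" "multilinear q" "mpoly_vars p \<inter> mpoly_vars q = {}"
  shows "multilinear (p * q)"
  unfolding multilinear_def
proof (intro ballI allI)
  fix t x assume "t \<in> Poly_Mapping.keys (p * q)"
  then obtain a b where ab: "a \<in> Poly_Mapping.keys p" "b \<in> Poly_Mapping.keys q" "t = a + b"
    using keys_mult[of p q] by blast
  have "x \<notin> Poly_Mapping.keys a \<or> x \<notin> Poly_Mapping.keys b"
    using assms(3) ab by (auto simp: mpoly_vars_def)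
  then have "Poly_Mapping.lookup a x = 0 \<or> Poly_Mapping.lookup b x = 0"
    by (simp add: in_keys_iff)
  moreover have "Poly_Mapping.lookup a x \<le> 1" "Poly_Mapping.lookup b x \<le> 1"
    using assms(1,2) ab by (auto simp: multilinear_def)
  ultimately show "Poly_Mapping.lookup t x \<le> 1"
    using ab(3) by (auto simp: lookup_add)
qed

lemma multilinear_mconst_mult: "multilinear p \<Longrightarrow> multilinear (mconst c * p)"
  by (rule multilinear_mult) simp_all

section \<open>Sums of products of linear forms\<close>

definition lin_factor :: "'a \<times> 'a \<Rightarrow> 'v \<Rightarrow> ('v fmc_var, 'a::comm_ring_1) mpoly" where
  "lin_factor l v = mconst (fst l) * mvar (Pos v) + mconst (snd l)"

text \<open>Each factor has a variable of its own, so that the products are multilinear; the pairs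
  \<open>(0, 1)\<close> give trivial factors, which lets all lines share one index set.\<close>

definition lin_prod :: "'v set \<Rightarrow> ('v \<Rightarrow> 'a \<times> 'a) \<Rightarrow> ('v fmc_var, 'a::comm_ring_1) mpoly" where
  "lin_prod W l = (\<Prod>v\<in>W. lin_factor (l v) v)"

text \<open>\<open>K\<close> is an upper bound on the number of products, since \<open>zero\<close>
  holds for every \<open>K\<close>. The predicate speaks of polynomials, so algebraic identities
  apply directly; formulas are built from it only once.\<close>

inductive sum_of_prods ::
  "'v set \<Rightarrow> nat \<Rightarrow> ('v fmc_var, 'a::comm_ring_1) mpoly \<Rightarrow> bool" for W where
  zero: "sum_of_prods W K 0"
| step: "sum_of_prods W K p \<Longrightarrow> sum_of_prods W (Suc K) (mconst c * lin_prod W l + p)"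

lemma lin_factor_vars: "mpoly_vars (lin_factor l v) \<subseteq> {Pos v}"
  using mpoly_vars_add[of "mconst (fst l) * mvar (Pos v)" "mconst (snd l)", unfolded mpoly_vars_mconst]
    mpoly_vars_mult[of "mconst (fst l)" "mvar (Pos v)", unfolded mpoly_vars_mconst]
    mpoly_vars_mvar[of "Pos v"]
  unfolding lin_factor_def by blast

lemma lin_factor_multilinear: "multilinear (lin_factor l v)"
  unfolding lin_factor_def by (intro multilinear_add multilinear_mconst_mult) simp_all

lemma lin_prod_vars: "mpoly_vars (lin_prod W l) \<subseteq> Pos ` W"
proof (induction W rule: infinite_finite_induct)
  case (insert v W)
  then show ?case
    using mpoly_vars_mult[of "lin_factor (l v) v" "lin_prod W l"] lin_factor_vars[of "l v" v]
    by (auto simp: lin_prod_def)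
qed (simp_all add: lin_prod_def flip: mconst_1)

lemma lin_prod_multilinear: "multilinear (lin_prod W l)"
proof (induction W rule: infinite_finite_induct)
  case (insert v W)
  have "mpoly_vars (lin_factor (l v) v) \<inter> mpoly_vars (lin_prod W l) = {}"
    using lin_factor_vars[of "l v" v] lin_prod_vars[of W l] insert by auto
  then show ?case
    using insert by (auto simp: lin_prod_def intro: multilinear_mult lin_factor_multilinear)
qed (simp_all add: lin_prod_def flip: mconst_1)

lemma lin_prod_extend:
  assumes "finite W'" "W \<subseteq> W'"
  shows "lin_prod W l = lin_prod W' (\<lambda>v. if v \<in> W then l v else (0, 1))"
  unfolding lin_prod_def using assms
  by (intro prod.mono_neutral_cong_left) (auto simp: lin_factor_def)

lemma lin_prod_Un:
  assumes "finite W" "finite W'" "W \<inter> W' = {}"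
  shows "lin_prod W l * lin_prod W' l' = lin_prod (W \<union> W') (\<lambda>v. if v \<in> W then l v else l' v)"
proof -
  have "lin_prod W l = (\<Prod>v\<in>W. lin_factor (if v \<in> W then l v else l' v) v)"
    by (simp add: lin_prod_def)
  moreover have "lin_prod W' l' = (\<Prod>v\<in>W'. lin_factor (if v \<in> W then l v else l' v) v)"
    unfolding lin_prod_def using assms(3) by (intro prod.cong) auto
  ultimately show ?thesis
    using assms by (simp add: lin_prod_def prod.union_disjoint)
qed

section \<open>Closure of sums of products under the ring operations\<close>

lemma sum_of_prods_mono: "sum_of_prods W K p \<Longrightarrow> K \<le> L \<Longrightarrow> sum_of_prods W L p"
proof (induction arbitrary: L rule: sum_of_prods.induct)
  case (step K p c l)
  then show ?case by (cases L) (auto intro: sum_of_prods.step)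
qed (rule sum_of_prods.zero)

lemma sum_of_prods_add:
  "sum_of_prods W K p \<Longrightarrow> sum_of_prods W L q \<Longrightarrow> sum_of_prods W (K + L) (p + q)"
proof (induction rule: sum_of_prods.induct)
  case (zero K)
  then show ?case by (simp add: sum_of_prods_mono)
next
  case (step K p c l)
  from sum_of_prods.step[OF step.IH[OF step.prems], of c l] show ?case
    by (simp add: add.assoc)
qed

lemma sum_of_prods_scale: "sum_of_prods W K p \<Longrightarrow> sum_of_prods W K (mconst a * p)"
proof (induction rule: sum_of_prods.induct)
  case (step K p c l)
  from sum_of_prods.step[OF step.IH, of "a * c" l] show ?case
    by (simp add: mconst_mult algebra_simps)
qed (simp add: sum_of_prods.zero)

lemma sum_of_prods_sum:
  assumes "\<And>i. i \<in> I \<Longrightarrow> sum_of_prods W k (p i)"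
  shows "sum_of_prods W (card I * k) (\<Sum>i\<in>I. p i)"
  using assms
proof (induction I rule: infinite_finite_induct)
  case (insert i I)
  then show ?case
    using sum_of_prods_add[of W k "p i" "card I * k" "sum p I"] by simp
qed (simp_all add: sum_of_prods.zero)

lemma sum_of_prods_lin_prod: "sum_of_prods W 1 (lin_prod W l)"
  using sum_of_prods.step[OF sum_of_prods.zero[of W 0], of 1 l] by simp

lemma sum_of_prods_extend:
  assumes "sum_of_prods W K p" "finite W'" "W \<subseteq> W'"
  shows "sum_of_prods W' K p"
  using assms(1)
proof (induction rule: sum_of_prods.induct)
  case (step K p c l)
  then show ?case
    unfolding lin_prod_extend[OF assms(2,3), of l] by (intro sum_of_prods.step)
qed (rule sum_of_prods.zero)

text \<open>Distributing gives \<open>K * L\<close> pairs of products. As \<open>W\<close> and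
  \<open>W'\<close> are disjoint, each pair merges into a single product of linear forms over the
  union. The auxiliary fact treats one product on the left.\<close>

lemma sum_of_prods_mult:
  assumes "sum_of_prods W K p" "sum_of_prods W' L q" "finite W" "finite W'" "W \<inter> W' = {}"
  shows "sum_of_prods (W \<union> W') (K * L) (p * q)"
proof -
  have *: "sum_of_prods (W \<union> W') L (lin_prod W l * q)" for l
    using assms(2)
  proof (induction rule: sum_of_prods.induct)
    case (step L q c l')
    from sum_of_prods.step[OF step.IH, of c "\<lambda>v. if v \<in> W then l v else l' v"] show ?case
      by (simp add: algebra_simps flip: lin_prod_Un[OF assms(3-5)])
  qed (simp add: sum_of_prods.zero)
  from assms(1) show ?thesis
  proof (induction rule: sum_of_prods.induct)
    case (step K p c l)
    from sum_of_prods_add[OF sum_of_prods_scale[OF *[of l], of c] step.IH] show ?case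
      by (simp add: algebra_simps)
  qed (simp add: sum_of_prods.zero)
qed

lemma sum_of_prods_vars: "sum_of_prods W K p \<Longrightarrow> mpoly_vars p \<subseteq> Pos ` W"
proof (induction rule: sum_of_prods.induct)
  case (step K p c l)
  have "mpoly_vars (mconst c * lin_prod W l) \<subseteq> Pos ` W"
    using order.trans[OF mpoly_vars_mult[of "mconst c" "lin_prod W l"]] lin_prod_vars[of W l]
    by simp
  with step.IH show ?case
    by (intro order.trans[OF mpoly_vars_add] Un_least)
qed simp

text \<open>The formula is a sum of products of two-term sums, hence of depth 3. A factor has three
  nodes and a product one more gate; the remaining 1 in the size is the root.\<close>

lemma sum_of_prods_formula:
  fixes p :: "('v fmc_var, 'a::comm_ring_1) mpoly"
  assumes "sum_of_prods W K p" "finite W" "W \<noteq> {}"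
  shows "\<exists>f. computes f = p \<and> proper_formula f \<and> formula_vars f \<subseteq> Pos ` W \<and>
    multilinear_formula f \<and> multilinear p \<and> formula_depth f \<le> 3 \<and>
    formula_size f \<le> 1 + K * (1 + 3 * card W)"
proof -
  obtain ws where ws: "set ws = W" "distinct ws"
    using finite_distinct_list[OF assms(2)] by blast
  define fac :: "'a \<times> 'a \<Rightarrow> 'v \<Rightarrow> ('v fmc_var, 'a) aformula" where
    "fac l v = PlusGate [(fst l, VarLeaf (Pos v)), (snd l, ConstLeaf 1)]" for l v
  define mon where "mon l = TimesGate (map (\<lambda>v. (1, fac (l v) v)) ws)" for l
  have fac: "computes (fac l v) = lin_factor l v" for l v
    by (simp add: fac_def lin_factor_def)
  have comp: "computes (mon l) = lin_prod W l" for l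
    using prod.distinct_set_conv_list[OF ws(2), of "\<lambda>v. lin_factor (l v) v"] ws(1)
    by (simp add: mon_def lin_prod_def fac o_def)
  have "length ws = card W"
    using distinct_card[OF ws(2)] unfolding ws(1) by (rule sym)
  moreover have "formula_size (fac l v) = 3" for l v
    by (simp add: fac_def)
  ultimately have size: "formula_size (mon l) = 1 + 3 * card W" for l
    by (simp add: mon_def o_def sum_list_triv)
  have W_ne: "ws \<noteq> []"
    using assms(3) ws(1) by auto
  have depth: "formula_depth (mon l) \<le> 2" for l
  proof -
    have "formula_depth (fac l v) = 1" for l v
      by (simp add: fac_def)
    then show ?thesis
      using W_ne by (simp add: mon_def image_image image_constant_conv)
  qed
  have proper: "proper_formula (mon l)" for l
    using assms(3) ws by (auto simp: mon_def fac_def)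
  have vars: "formula_vars (mon l) \<subseteq> Pos ` W" for l
    using ws by (auto simp: mon_def fac_def)
  have mlfac: "multilinear_formula (fac l v)" for l v
    using lin_factor_multilinear[of l v] fac[of l v]
    by (simp add: fac_def)
  have ml: "multilinear_formula (mon l)" for l
    unfolding mon_def multilinear_formula.simps comp[unfolded mon_def]
    using mlfac lin_prod_multilinear[of W l] by auto
  have "\<exists>es. computes (PlusGate es) = p \<and> length es \<le> K \<and> multilinear p \<and>
     (\<forall>e\<in>set es. \<exists>l. snd e = mon l)"
    using assms(1)
  proof (induction rule: sum_of_prods.induct)
    case (zero K)
    show ?case by (intro exI[of _ "[]"]) simp
  next
    case (step K p c l)
    then obtain es where es: "computes (PlusGate es) = p" "length es \<le> K" "multilinear p"
       "\<forall>e\<in>set es. \<exists>l. snd e = mon l" by blast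
    have "computes (PlusGate ((c, mon l) # es)) = mconst c * lin_prod W l + p"
      using es(1) by (simp add: comp)
    moreover have "multilinear (mconst c * lin_prod W l + p)"
      by (intro multilinear_add multilinear_mconst_mult lin_prod_multilinear es(3))
    moreover have "\<forall>e\<in>set ((c, mon l) # es). \<exists>l. snd e = mon l"
      using es(4) by auto
    ultimately show ?case
      using es(2) by (intro exI[of _ "(c, mon l) # es"]) simp
  qed
  then obtain es where es: "computes (PlusGate es) = p" "length es \<le> K" "multilinear p"
    "\<forall>e\<in>set es. \<exists>l. snd e = mon l" by blast
  show ?thesis
  proof (cases "es = []")
    \<comment> \<open>A sum gate must have a child, so the empty sum becomes the leaf 0.\<close>
    case True
    with es have "p = 0" by simp
    then show ?thesis by (intro exI[of _ "ConstLeaf 0"]) simp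
  next
    case False
    have child: "proper_formula f \<and> formula_vars f \<subseteq> Pos ` W \<and> multilinear_formula f \<and>
        formula_depth f \<le> 2 \<and> formula_size f = 1 + 3 * card W" if e: "(c, f) \<in> set es" for c f
    proof -
      obtain l where "f = mon l" using bspec[OF es(4) e] by auto
      then show ?thesis using proper vars ml depth size by blast
    qed
    have "formula_depth (PlusGate es) \<le> 3"
      using False child by (auto simp: case_prod_beta)
    moreover have "sum_list (map (\<lambda>(c, f). formula_size f) es) = length es * (1 + 3 * card W)"
    proof -
      have "map (\<lambda>(c, f). formula_size f) es = map (\<lambda>_. 1 + 3 * card W) es"
        by (rule map_cong) (use child in auto)
      then show ?thesis by (simp only: sum_list_triv) simp
    qed
    then have "formula_size (PlusGate es) \<le> 1 + K * (1 + 3 * card W)"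
      using mult_right_mono[OF es(2), of "1 + 3 * card W"] by simp
    moreover have "proper_formula (PlusGate es)"
      using False child by auto
    moreover have "formula_vars (PlusGate es) \<subseteq> Pos ` W"
      unfolding formula_vars.simps using child by blast
    moreover have "multilinear_formula (PlusGate es)"
      unfolding multilinear_formula.simps es(1) using es(3) child by blast
    ultimately show ?thesis
      by (intro exI[of _ "PlusGate es"] conjI es(1,3))
  qed
qed

section \<open>Derivations with a bounded number of lines\<close>

text \<open>\<open>V\<close> is the ambient set of variables, \<open>W\<close> the set over which
  the products of all lines range, and \<open>K\<close> bounds the number of products in a line.
  Fixing both gives one size bound for every line, so afterwards only lines have to be
  counted.\<close>

locale fmc_lines =
  fixes V W :: "'v set" and Q :: "('v fmc_var, 'a::comm_ring_1) mpoly set" and K :: nat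
  assumes finite_W: "finite W" and W_nonempty: "W \<noteq> {}" and W_subset: "W \<subseteq> V"
begin

definition line :: "('v fmc_var, 'a) mpoly set \<Rightarrow> ('v fmc_var, 'a) aformula \<Rightarrow> bool" where
  "line X f \<longleftrightarrow> proper_formula f \<and> formula_vars f \<subseteq> fmc_vars V \<and> multilinear_formula f \<and>
     multilinear (computes f) \<and> formula_depth f \<le> 3 \<and>
     formula_size f \<le> 1 + K * (1 + 3 * card W) \<and> fmc_step V Q X (computes f)"

definition valid :: "('v fmc_var, 'a) aformula list \<Rightarrow> bool" where
  "valid \<pi> \<longleftrightarrow> (\<forall>i<length \<pi>. line (computes ` set (take i \<pi>)) (\<pi> ! i))"

text \<open>Quantifying over all valid lists that contain \<open>X\<close> locates premises by value
  instead of by index. Derivations then compose by appending, and lines already present are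
  shared.\<close>

definition derives ::
  "nat \<Rightarrow> ('v fmc_var, 'a) mpoly set \<Rightarrow> ('v fmc_var, 'a) mpoly set \<Rightarrow> bool" where
  "derives N X Y \<longleftrightarrow> (\<forall>\<pi>. valid \<pi> \<and> X \<subseteq> computes ` set \<pi> \<longrightarrow>
     (\<exists>\<rho>. valid (\<pi> @ \<rho>) \<and> length \<rho> \<le> N \<and> Y \<subseteq> computes ` set (\<pi> @ \<rho>)))"

lemma valid_snoc: "valid (\<pi> @ [f]) \<longleftrightarrow> valid \<pi> \<and> line (computes ` set \<pi>) f"
  by (simp add: valid_def nth_append All_less_Suc conj_commute)

lemma derives_single:
  assumes "sum_of_prods W K p" "fmc_step V Q X p"
  shows "derives 1 X {p}"
  unfolding derives_def
proof (intro allI impI, elim conjE)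
  fix \<pi> assume \<pi>: "valid \<pi>" "X \<subseteq> computes ` set \<pi>"
  obtain f where f: "computes f = p" "proper_formula f" "formula_vars f \<subseteq> Pos ` W"
    "multilinear_formula f" "multilinear p" "formula_depth f \<le> 3"
    "formula_size f \<le> 1 + K * (1 + 3 * card W)"
    using sum_of_prods_formula[OF assms(1) finite_W W_nonempty] by blast
  have "fmc_step V Q (computes ` set \<pi>) p"
    using assms(2) \<pi>(2) unfolding fmc_step_def by blast
  moreover have "formula_vars f \<subseteq> fmc_vars V"
    using f(3) W_subset unfolding fmc_vars_def by blast
  ultimately have "line (computes ` set \<pi>) f"
    using f by (auto simp: line_def)
  then show "\<exists>\<rho>. valid (\<pi> @ \<rho>) \<and> length \<rho> \<le> 1 \<and> {p} \<subseteq> computes ` set (\<pi> @ \<rho>)"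
    using \<pi> f(1) by (intro exI[of _ "[f]"]) (simp add: valid_snoc)
qed

lemma derives_trans:
  assumes "derives N X Y" "derives M (X \<union> Y) Z"
  shows "derives (N + M) X (Y \<union> Z)"
  unfolding derives_def
proof (intro allI impI, elim conjE)
  fix \<pi> assume \<pi>: "valid \<pi>" "X \<subseteq> computes ` set \<pi>"
  then obtain \<rho> where \<rho>: "valid (\<pi> @ \<rho>)" "length \<rho> \<le> N" "Y \<subseteq> computes ` set (\<pi> @ \<rho>)"
    using assms(1) unfolding derives_def by blast
  have "X \<union> Y \<subseteq> computes ` set (\<pi> @ \<rho>)" using \<pi> \<rho> by auto
  then obtain \<rho>' where \<rho>': "valid ((\<pi> @ \<rho>) @ \<rho>')" "length \<rho>' \<le> M"
    "Z \<subseteq> computes ` set ((\<pi> @ \<rho>) @ \<rho>')"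
    using assms(2) \<rho>(1) unfolding derives_def by blast
  show "\<exists>\<rho>. valid (\<pi> @ \<rho>) \<and> length \<rho> \<le> N + M \<and> Y \<union> Z \<subseteq> computes ` set (\<pi> @ \<rho>)"
    using \<rho> \<rho>' by (intro exI[of _ "\<rho> @ \<rho>'"]) auto
qed

text \<open>Conclusions may also be read off the premises, because an extension keeps all earlier
  lines.\<close>

lemma derives_mono:
  assumes "derives N X Y" "X \<subseteq> X'" "N \<le> N'" "Y' \<subseteq> X' \<union> Y"
  shows "derives N' X' Y'"
  unfolding derives_def
proof (intro allI impI, elim conjE)
  fix \<pi> assume \<pi>: "valid \<pi>" "X' \<subseteq> computes ` set \<pi>"
  then obtain \<rho> where "valid (\<pi> @ \<rho>)" "length \<rho> \<le> N" "Y \<subseteq> computes ` set (\<pi> @ \<rho>)"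
    using assms(1,2) unfolding derives_def by blast
  then show "\<exists>\<rho>. valid (\<pi> @ \<rho>) \<and> length \<rho> \<le> N' \<and> Y' \<subseteq> computes ` set (\<pi> @ \<rho>)"
    using \<pi> assms(3,4) by (intro exI[of _ \<rho>]) auto
qed

lemma derives_subset: "Y \<subseteq> X \<Longrightarrow> derives 0 X Y"
  unfolding derives_def by (intro allI impI exI[of _ "[]"]) auto

lemma derives_UN:
  assumes "finite I" "\<And>i. i \<in> I \<Longrightarrow> derives N X (Y i)"
  shows "derives (card I * N) X (\<Union>i\<in>I. Y i)"
  using assms
proof (induction I rule: finite_induct)
  case (insert i I)
  have "derives (N + card I * N) X (Y i \<union> (\<Union>i\<in>I. Y i))"
    using insert by (intro derives_trans) (auto intro: derives_mono[of "card I * N" X "\<Union>i\<in>I. Y i"])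
  then show ?case using insert by simp
qed (simp add: derives_subset)

lemma refutation_of_derives:
  assumes "derives N {} {1}"
  shows "\<exists>\<pi>. fmc_refutation V Q \<pi> \<and> fmc_depth_at_most 3 \<pi> \<and>
    fmc_size \<pi> \<le> N * (1 + K * (1 + 3 * card W))"
proof -
  have "valid []" by (simp add: valid_def)
  then have "\<exists>\<rho>. valid ([] @ \<rho>) \<and> length \<rho> \<le> N \<and> {1} \<subseteq> computes ` set ([] @ \<rho>)"
    using assms unfolding derives_def by (elim allE[of _ "[]"]) simp
  then obtain \<rho> where \<rho>: "valid \<rho>" "length \<rho> \<le> N" "1 \<in> computes ` set \<rho>"
    by auto
  then obtain i where i: "i < length \<rho>" "computes (\<rho> ! i) = 1"
    by (auto simp: in_set_conv_nth)
  \<comment> \<open>A refutation has to end in 1, so the list is cut just after an occurrence of 1;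
    a prefix of a valid list is valid.\<close>
  define \<pi> where "\<pi> = take (Suc i) \<rho>"
  have length: "length \<pi> = Suc i"
    using i(1) by (simp add: \<pi>_def)
  have line: "line {computes (\<pi> ! j) | j. j < l} (\<pi> ! l)" if "l < length \<pi>" for l
  proof -
    have "line (computes ` set (take l \<rho>)) (\<rho> ! l)"
      using \<rho>(1) that i(1) length by (simp add: valid_def)
    moreover have "computes ` set (take l \<rho>) = {computes (\<pi> ! j) | j. j < l}"
    proof -
      have "take l \<rho> = take l \<pi>"
        using that length by (simp add: \<pi>_def min_def)
      then have "set (take l \<rho>) = (!) \<pi> ` {0..<l}"
        using that by (simp add: nth_image)
      then show ?thesis by auto
    qed
    moreover have "\<rho> ! l = \<pi> ! l"
      using that length by (simp add: \<pi>_def)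
    ultimately show ?thesis by simp
  qed
  have "computes (last \<pi>) = 1"
    using i by (simp add: take_Suc_conv_app_nth \<pi>_def)
  moreover have "\<pi> \<noteq> []"
    using length by auto
  ultimately have "fmc_refutation V Q \<pi>"
    using line by (simp add: fmc_refutation_def fmc_proof_def line_def)
  moreover have member: "formula_depth f \<le> 3" "formula_size f \<le> 1 + K * (1 + 3 * card W)"
    if f: "f \<in> set \<pi>" for f
  proof -
    obtain l where "l < length \<pi>" "f = \<pi> ! l"
      using f by (metis in_set_conv_nth)
    then show "formula_depth f \<le> 3" "formula_size f \<le> 1 + K * (1 + 3 * card W)"
      using line[of l] by (simp_all add: line_def)
  qed
  then have "fmc_depth_at_most 3 \<pi>"
    by (simp add: fmc_depth_at_most_def)
  moreover have "fmc_size \<pi> \<le> N * (1 + K * (1 + 3 * card W))"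
  proof -
    have "fmc_size \<pi> \<le> (\<Sum>f\<leftarrow>\<pi>. 1 + K * (1 + 3 * card W))"
      unfolding fmc_size_def by (intro sum_list_mono member(2))
    also have "\<dots> = length \<pi> * (1 + K * (1 + 3 * card W))"
      by (simp add: sum_list_triv)
    also have "\<dots> \<le> N * (1 + K * (1 + 3 * card W))"
      using \<rho>(2) i(1) length by (intro mult_le_mono1) simp
    finally show ?thesis .
  qed
  ultimately show ?thesis by blast
qed

section \<open>Single rule applications as derivations\<close>

lemma derives_axiom: "p \<in> Q \<Longrightarrow> sum_of_prods W K p \<Longrightarrow> derives 1 X {p}"
  by (rule derives_single) (simp_all add: fmc_step_def)

lemma derives_mult:
  assumes "p \<in> X" "sum_of_prods W K (q * p)" "mpoly_vars q \<subseteq> Pos ` W"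
  shows "derives 1 X {q * p}"
proof (rule derives_single[OF assms(2)])
  have "mpoly_vars q \<subseteq> fmc_vars V"
    using assms(3) W_subset unfolding fmc_vars_def by blast
  then show "fmc_step V Q X (q * p)"
    using assms(1) unfolding fmc_step_def by blast
qed

lemma derives_add:
  assumes "p \<in> X" "q \<in> X" "sum_of_prods W K (p + q)"
  shows "derives 1 X {p + q}"
proof (rule derives_single[OF assms(3)])
  have "p + q = mconst 1 * p + mconst 1 * q" by simp
  then show "fmc_step V Q X (p + q)"
    using assms(1,2) unfolding fmc_step_def by blast
qed

text \<open>The summands are added one at a time, starting from the empty sum \<open>0\<close>. Each
  partial sum is a line of its own, and \<open>card I * k \<le> K\<close> keeps all of them
  short.\<close>

lemma derives_sum:
  assumes "finite I" "0 \<in> X" "\<And>i. i \<in> I \<Longrightarrow> p i \<in> X" "\<And>i. i \<in> I \<Longrightarrow> sum_of_prods W k (p i)"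
    "card I * k \<le> K"
  shows "derives (card I) X {\<Sum>i\<in>I. p i}"
  using assms
proof (induction I rule: finite_induct)
  case (insert i I)
  have "sum_of_prods W K (\<Sum>i\<in>insert i I. p i)"
    using sum_of_prods_sum[of "insert i I" W k p] insert by (blast intro: sum_of_prods_mono)
  then have "derives 1 (X \<union> {sum p I}) {p i + sum p I}"
    using insert by (intro derives_add) auto
  moreover have "derives (card I) X {sum p I}"
    using insert by (intro insert.IH) auto
  ultimately have "derives (card I + 1) X ({sum p I} \<union> {p i + sum p I})"
    by (rule derives_trans[rotated])
  then show ?case
    by (rule derives_mono) (use insert in simp_all)
qed (simp add: derives_subset)

end

section \<open>Weight indicators\<close>

text \<open>The weight \<open>w c\<close> is the coefficient of degree \<open>t\<close> in the
  Lagrange basis polynomial of the node \<open>c\<close>. In characteristic 0 the nodes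
  \<open>0, ..., d\<close> are distinct field elements.\<close>

lemma exists_interpolation_weights:
  fixes d t :: nat
  shows "\<exists>w :: nat \<Rightarrow> 'a::field_char_0. \<forall>s\<le>d.
    (\<Sum>c\<le>d. w c * of_nat c ^ s) = (if s = t then 1 else 0)"
proof -
  define l :: "nat \<Rightarrow> 'a poly" where
    \<comment> \<open>The Lagrange basis polynomial: 1 at the node \<open>c\<close> and 0 at the
      other nodes.\<close>
    "l c = (\<Prod>c'\<in>{..d} - {c}. smult (1 / (of_nat c - of_nat c')) [:- of_nat c', 1:])" for c
  have degree: "degree (l c) \<le> d" if "c \<le> d" for c
  proof -
    have "degree (l c) \<le> (\<Sum>c'\<in>{..d} - {c}. 1)"
      unfolding l_def by (intro order.trans[OF degree_prod_sum_le] sum_mono) simp_all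
    then show ?thesis using that by simp
  qed
  have eval: "poly (l c) (of_nat c') = (if c = c' then 1 else 0)" if "c \<le> d" "c' \<le> d" for c c'
  proof (cases "c = c'")
    case True
    have "(of_nat c' - of_nat x) / (of_nat c' - of_nat x) = (1 :: 'a)" if "x \<noteq> c'" for x :: nat
      using that by simp
    with True show ?thesis
      by (auto simp: l_def poly_prod simp flip: diff_divide_distrib intro!: prod.neutral)
  qed (use that in \<open>auto simp: l_def poly_prod\<close>)
  \<comment> \<open>Both sides have degree at most \<open>d\<close> and agree at
    \<open>d + 1\<close> points.\<close>
  have expand: "(\<Sum>c\<le>d. smult (of_nat c ^ s) (l c)) = monom 1 s" if "s \<le> d" for s
  proof (rule poly_eqI_degree[where A = "of_nat ` {..d}"])
    have card: "card (of_nat ` {..d} :: 'a set) = Suc d"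
      by (simp add: card_image inj_on_def)
    have "degree (\<Sum>c\<le>d. smult (of_nat c ^ s) (l c)) \<le> d"
      by (intro degree_sum_le) (auto intro: order.trans[OF degree_smult_le] degree)
    then show "card (of_nat ` {..d} :: 'a set) > degree (\<Sum>c\<le>d. smult (of_nat c ^ s) (l c))"
      using card by simp
    show "card (of_nat ` {..d} :: 'a set) > degree (monom (1::'a) s)"
      using card that by (simp add: degree_monom_eq)
    fix x :: 'a assume "x \<in> of_nat ` {..d}"
    then obtain c' where "c' \<le> d" "x = of_nat c'" by auto
    then show "poly (\<Sum>c\<le>d. smult (of_nat c ^ s) (l c)) x = poly (monom 1 s) x"
      by (simp add: poly_sum eval poly_monom if_distrib[of "(*) _"] sum.delta cong: if_cong)
  qed
  \<comment> \<open>This compares the coefficients of degree \<open>t\<close> in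
    \<open>expand\<close>.\<close>
  have "(\<Sum>c\<le>d. coeff (l c) t * of_nat c ^ s) = (if s = t then 1 else 0)" if "s \<le> d" for s
    using arg_cong[OF expand[OF that], of "\<lambda>p. coeff p t"]
    by (simp add: coeff_sum mult.commute)
  then show ?thesis by (intro exI[of _ "\<lambda>c. coeff (l c) t"]) blast
qed

text \<open>The coefficients of \<open>p\<close> are themselves multivariate polynomials, but the
  weights are scalars depending only on \<open>d\<close> and \<open>t\<close>, so the previous
  identities apply to each power of the variable of \<open>p\<close> separately.\<close>

lemma coeff_eq_interpolation:
  fixes d t :: nat
  shows "\<exists>w :: nat \<Rightarrow> 'a::field_char_0. \<forall>p :: ('x, 'a) mpoly poly. degree p \<le> d \<longrightarrow>
    coeff p t = (\<Sum>c\<le>d. mconst (w c) * poly p (mconst (of_nat c)))"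
proof -
  obtain w :: "nat \<Rightarrow> 'a" where
    w: "\<And>s. s \<le> d \<Longrightarrow> (\<Sum>c\<le>d. w c * of_nat c ^ s) = (if s = t then 1 else 0)"
    using exists_interpolation_weights by blast
  have "coeff p t = (\<Sum>c\<le>d. mconst (w c) * poly p (mconst (of_nat c)))" if "degree p \<le> d"
    for p :: "('x, 'a) mpoly poly"
  proof -
    have "poly p x = (\<Sum>s\<le>d. coeff p s * x ^ s)" for x
      unfolding poly_altdef using that
      by (intro sum.mono_neutral_left) (auto simp: coeff_eq_0)
    then have "(\<Sum>c\<le>d. mconst (w c) * poly p (mconst (of_nat c))) =
        (\<Sum>c\<le>d. \<Sum>s\<le>d. coeff p s * mconst (w c * of_nat c ^ s))"
      by (simp add: sum_distrib_left mconst_mult mconst_power mult_ac)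
    also have "\<dots> = (\<Sum>s\<le>d. coeff p s * mconst (\<Sum>c\<le>d. w c * of_nat c ^ s))"
      by (subst sum.swap) (simp add: mconst_sum sum_distrib_left)
    also have "\<dots> = (\<Sum>s\<le>d. if s = t then coeff p s else 0)"
      by (intro sum.cong) (auto simp: w)
    also have "\<dots> = coeff p t"
      using that by (auto simp: coeff_eq_0)
    finally show ?thesis by simp
  qed
  then show ?thesis by blast
qed

text \<open>The product from the overview, with the polynomial variable in the role of
  \<open>z\<close>; \<open>exactly U t\<close> is then \<open>E_t(U)\<close>.\<close>

definition count_poly :: "'v set \<Rightarrow> ('v fmc_var, 'a::comm_ring_1) mpoly poly" where
  "count_poly U = (\<Prod>v\<in>U. [:1 - mvar (Pos v), mvar (Pos v):])"

definition exactly :: "'v set \<Rightarrow> nat \<Rightarrow> ('v fmc_var, 'a::comm_ring_1) mpoly" where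
  "exactly U t = coeff (count_poly U) t"

section \<open>Evaluations and coefficients of the generating polynomial\<close>

lemma degree_count_poly: "finite U \<Longrightarrow> degree (count_poly U) \<le> card U"
  unfolding count_poly_def card_eq_sum
  by (intro order.trans[OF degree_prod_sum_le] sum_mono) auto

lemma exactly_empty: "exactly {} t = (if t = 0 then 1 else 0)"
  by (simp add: exactly_def count_poly_def)

lemma exactly_0: "finite U \<Longrightarrow> exactly U 0 = (\<Prod>v\<in>U. 1 - mvar (Pos v))"
  by (simp add: exactly_def count_poly_def poly_prod flip: poly_0_coeff_0)

text \<open>Splitting off the factor of \<open>v\<close> and comparing coefficients: weight
  \<open>t + 1\<close> arises with \<open>x_v = 0\<close> or with \<open>x_v = 1\<close>.\<close>

lemma exactly_insert_Suc:
  "finite U \<Longrightarrow> v \<notin> U \<Longrightarrow> exactly (insert v U) (Suc t) =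
    (1 - mvar (Pos v)) * exactly U (Suc t) + mvar (Pos v) * exactly U t"
  by (simp add: exactly_def count_poly_def)

text \<open>The generating polynomial of a disjoint union is a product, and the coefficients of a
  product are convolutions.\<close>

lemma exactly_Un:
  assumes "finite U" "finite U'" "U \<inter> U' = {}"
  shows "exactly (U \<union> U') t = (\<Sum>a\<le>t. exactly U a * exactly U' (t - a))"
  using assms by (simp add: exactly_def count_poly_def prod.union_disjoint coeff_mult)

text \<open>At \<open>z = 1\<close> every factor of the generating polynomial is
  \<open>(1 - x_v) + x_v = 1\<close>.\<close>

lemma sum_exactly:
  fixes U :: "'v set"
  assumes "finite U"
  shows "(\<Sum>t\<le>card U. exactly U t) = (1 :: ('v fmc_var, 'a::comm_ring_1) mpoly)"
proof -
  let ?p = "count_poly U :: ('v fmc_var, 'a) mpoly poly"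
  have "poly ?p 1 = (\<Sum>t\<le>card U. exactly U t)"
    unfolding poly_altdef exactly_def using degree_count_poly[OF assms]
    by (intro sum.mono_neutral_cong_left) (auto simp: coeff_eq_0)
  then show ?thesis
    by (simp add: count_poly_def poly_prod)
qed

text \<open>At \<open>z = c\<close> the factor of \<open>v\<close> becomes
  \<open>1 + (c - 1) x_v\<close>, so each of the \<open>card U + 1\<close> evaluations used in the
  interpolation is a single product of linear forms.\<close>

lemma sum_of_prods_exactly:
  fixes U :: "'v set"
  assumes "finite U"
  shows "sum_of_prods U (card U + 1) (exactly U t :: ('v fmc_var, 'a::field_char_0) mpoly)"
proof -
  let ?p = "count_poly U :: ('v fmc_var, 'a) mpoly poly"
  obtain w :: "nat \<Rightarrow> 'a" where
    "coeff ?p t = (\<Sum>c\<le>card U. mconst (w c) * poly ?p (mconst (of_nat c)))"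
    using coeff_eq_interpolation[of "card U" t] degree_count_poly[OF assms] by blast
  moreover have "poly ?p (mconst c) = lin_prod U (\<lambda>_. (c - 1, 1))" for c
    by (simp add: count_poly_def poly_prod lin_prod_def lin_factor_def mconst_diff algebra_simps)
  ultimately have "exactly U t =
      (\<Sum>c\<le>card U. mconst (w c) * lin_prod U (\<lambda>_. (of_nat c - 1, 1)))"
    by (simp add: exactly_def)
  moreover have "sum_of_prods U (card {..card U} * 1)
      (\<Sum>c\<le>card U. mconst (w c) * lin_prod U (\<lambda>_. (of_nat c - 1, 1)))"
    by (intro sum_of_prods_sum sum_of_prods_scale sum_of_prods_lin_prod)
  ultimately show ?thesis by simp
qed

lemma sum_of_prods_mvar: "sum_of_prods {v} 1 (mvar (Pos v))"
  using sum_of_prods_lin_prod[of "{v}" "\<lambda>_. (1, 0)"] by (simp add: lin_prod_def lin_factor_def)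

lemma sum_of_prods_not_mvar: "sum_of_prods {v} 1 (1 - mvar (Pos v))"
  using sum_of_prods_lin_prod[of "{v}" "\<lambda>_. (- 1, 1)"]
  by (simp add: lin_prod_def lin_factor_def mconst_minus)

section \<open>Deriving weight indicators\<close>

text \<open>\<open>K\<close> is the number of products in a sum of \<open>M\<close> terms, each of them a product of two sums of
  \<open>M\<close> products.\<close>

locale count_lines = fmc_lines V W Q K
  for V W :: "'v set" and Q :: "('v fmc_var, 'a::field_char_0) mpoly set" and K :: nat +
  fixes M :: nat
  assumes M_eq: "M = card W + 1" and K_eq: "K = M * (M * M)"
begin

section \<open>Bounds that keep all lines within \<open>K\<close> products\<close>

lemma M_ge_2: "2 \<le> M"
  using finite_W W_nonempty by (simp add: M_eq Suc_le_eq card_gt_0_iff)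

lemma two_M_le_K: "2 * M \<le> K"
  unfolding K_eq using M_ge_2 mult_le_mono[OF M_ge_2, of M "M * M"] by simp

lemma M_M_le_K: "M * M \<le> K"
  unfolding K_eq using M_ge_2 by simp

lemma M_le_K: "M \<le> K"
  using two_M_le_K by simp

lemma finite_subset_W: "U \<subseteq> W \<Longrightarrow> finite U"
  using finite_W by (rule finite_subset[rotated])

lemma sum_of_prods_W: "sum_of_prods U k p \<Longrightarrow> U \<subseteq> W \<Longrightarrow> k \<le> k' \<Longrightarrow> sum_of_prods W k' p"
  using sum_of_prods_extend[OF _ finite_W] sum_of_prods_mono by blast

lemma sum_of_prods_exactly_M:
  assumes "U \<subseteq> W"
  shows "sum_of_prods U M (exactly U t :: ('v fmc_var, 'a) mpoly)"
  by (rule sum_of_prods_mono[OF sum_of_prods_exactly[OF finite_subset_W[OF assms]]])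
    (simp add: M_eq card_mono finite_W assms)

lemma sum_of_prods_mult_W:
  assumes "sum_of_prods U k q" "sum_of_prods U' k' p" "U \<subseteq> W" "U' \<subseteq> W" "U \<inter> U' = {}"
  shows "sum_of_prods W (k * k') (q * p)"
  using sum_of_prods_mult[OF assms(1,2) _ _ assms(5)] finite_subset_W assms(3,4)
  by (intro sum_of_prods_W[of "U \<union> U'"]) auto

lemma derives_mult_disjoint:
  assumes "p \<in> X" "sum_of_prods U k q" "sum_of_prods U' k' p"
    "U \<subseteq> W" "U' \<subseteq> W" "U \<inter> U' = {}" "k * k' \<le> K"
  shows "derives 1 X {q * p}"
proof (rule derives_mult[OF assms(1)])
  show "sum_of_prods W K (q * p)"
    using sum_of_prods_mult_W[OF assms(2-6)] assms(7) by (rule sum_of_prods_mono)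
  show "mpoly_vars q \<subseteq> Pos ` W"
    using sum_of_prods_vars[OF assms(2)] assms(4) by blast
qed

text \<open>In each term of the convolution one factor is available, so a product step yields the
  term. There are \<open>t + 1 \<le> M\<close> terms, which cost at most \<open>M\<close> products
  and \<open>M\<close> additions.\<close>

lemma derives_exactly_Un:
  assumes U: "U \<subseteq> W" "U' \<subseteq> W" "U \<inter> U' = {}" and "t < M" and "0 \<in> X"
    and X: "\<And>a. a \<le> t \<Longrightarrow> exactly U a \<in> X \<or> exactly U' (t - a) \<in> X"
  shows "derives (2 * M) X {exactly (U \<union> U') t}"
proof -
  have 1: "derives 1 X {exactly U a * exactly U' (t - a)}" if "a \<le> t" for a
    using X[OF that]
  proof
    assume "exactly U' (t - a) \<in> X"
    then show ?thesis
      by (rule derives_mult_disjoint[OF _ sum_of_prods_exactly_M sum_of_prods_exactly_M])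
        (use U M_M_le_K in auto)
  next
    assume "exactly U a \<in> X"
    then have "derives 1 X {exactly U' (t - a) * exactly U a}"
      by (rule derives_mult_disjoint[OF _ sum_of_prods_exactly_M sum_of_prods_exactly_M])
        (use U M_M_le_K in auto)
    then show ?thesis by (simp add: mult.commute)
  qed
  define Y where "Y = (\<Union>a\<in>{..t}. {exactly U a * exactly U' (t - a) :: ('v fmc_var, 'a) mpoly})"
  have "derives (card {..t} * 1) X Y"
    unfolding Y_def using 1 by (intro derives_UN) auto
  moreover have "derives (card {..t}) (X \<union> Y) {\<Sum>a\<le>t. exactly U a * exactly U' (t - a)}"
  proof (rule derives_sum)
    show "sum_of_prods W (M * M) (exactly U a * exactly U' (t - a) :: ('v fmc_var, 'a) mpoly)" for a
      by (intro sum_of_prods_mult_W[OF _ _ U] sum_of_prods_exactly_M U)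
    \<comment> \<open>The value of \<open>K\<close> is chosen for this sum: at most \<open>M\<close>
      terms of \<open>M * M\<close> products each.\<close>
    show "card {..t} * (M * M) \<le> K"
      unfolding K_eq using \<open>t < M\<close> by (intro mult_right_mono) auto
  qed (use \<open>0 \<in> X\<close> in \<open>auto simp: Y_def\<close>)
  ultimately have "derives (card {..t} * 1 + card {..t}) X
      (Y \<union> {\<Sum>a\<le>t. exactly U a * exactly U' (t - a)})"
    by (rule derives_trans)
  moreover have "exactly (U \<union> U') t = (\<Sum>a\<le>t. exactly U a * exactly U' (t - a) :: ('v fmc_var, 'a) mpoly)"
    using U by (intro exactly_Un finite_subset_W)
  ultimately show ?thesis
    by (elim derives_mono) (use \<open>t < M\<close> in auto)
qed

text \<open>Adding \<open>u\<close> to \<open>U\<close> uses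
  \<open>E_1(U + u) x_v = (1 - x_u) E_1(U) x_v + E_0(U) x_u x_v\<close>. This takes four lines: the
  axiom \<open>x_u x_v\<close>, two products and one addition. The result supplies the missing term
  for weight 2 when \<open>v\<close> joins \<open>U\<close>.\<close>

lemma derives_exactly_1_mult_mvar:
  assumes "finite U" "insert v U \<subseteq> W" "v \<notin> U" "0 \<in> X"
    and "\<And>u. u \<in> U \<Longrightarrow> mvar (Pos u) * mvar (Pos v) \<in> Q"
  shows "derives (4 * card U) X {exactly U 1 * mvar (Pos v)}"
  using assms
proof (induction U rule: finite_induct)
  case empty
  then show ?case by (simp add: derives_subset exactly_empty)
next
  case (insert u U)
  let ?e = "exactly U 1 * mvar (Pos v) :: ('v fmc_var, 'a) mpoly"
    and ?x = "mvar (Pos u) * mvar (Pos v) :: ('v fmc_var, 'a) mpoly"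
  have W: "u \<in> W" "v \<in> W" "U \<subseteq> W" and ne: "u \<noteq> v" "v \<notin> U" "u \<notin> U"
    using insert by auto
  have sv: "sum_of_prods (insert v U) M ?e"
    using sum_of_prods_mult[OF sum_of_prods_exactly_M[OF W(3)] sum_of_prods_mvar[of v]]
      ne finite_subset_W[OF W(3)] by simp
  have sx: "sum_of_prods {u, v} 1 ?x"
    using sum_of_prods_mult[OF sum_of_prods_mvar[of u] sum_of_prods_mvar[of v]] ne by (simp add: insert_commute)
  have s1: "sum_of_prods W M ((1 - mvar (Pos u)) * ?e)"
    using sum_of_prods_mult_W[OF sum_of_prods_not_mvar[of u] sv] W ne by simp
  have s2: "sum_of_prods W M (exactly U 0 * ?x)"
    using sum_of_prods_mult_W[OF sum_of_prods_exactly_M[OF W(3)] sx] W ne by simp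
  have "derives (4 * card U) X {?e}"
    using insert W by (intro insert.IH) auto
  moreover have "derives 1 (X \<union> {?e}) {?x}"
    using insert.prems(4)[of u] sum_of_prods_W[OF sx, of K] W M_le_K M_ge_2
    by (intro derives_axiom) simp_all
  ultimately have "derives (4 * card U + 1) X ({?e} \<union> {?x})"
    by (rule derives_trans)
  moreover have "derives 1 (X \<union> ({?e} \<union> {?x})) {(1 - mvar (Pos u)) * ?e}"
    by (rule derives_mult_disjoint[OF _ sum_of_prods_not_mvar sv]) (use W ne M_le_K in auto)
  ultimately have "derives (4 * card U + 1 + 1) X (({?e} \<union> {?x}) \<union> {(1 - mvar (Pos u)) * ?e})"
    by (rule derives_trans)
  moreover have "derives 1 (X \<union> (({?e} \<union> {?x}) \<union> {(1 - mvar (Pos u)) * ?e})) {exactly U 0 * ?x}"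
    by (rule derives_mult_disjoint[OF _ sum_of_prods_exactly_M sx]) (use W ne M_le_K in auto)
  ultimately have "derives (4 * card U + 1 + 1 + 1) X
      ((({?e} \<union> {?x}) \<union> {(1 - mvar (Pos u)) * ?e}) \<union> {exactly U 0 * ?x})"
    by (rule derives_trans)
  moreover have "derives 1 (X \<union> ((({?e} \<union> {?x}) \<union> {(1 - mvar (Pos u)) * ?e}) \<union> {exactly U 0 * ?x}))
      {(1 - mvar (Pos u)) * ?e + exactly U 0 * ?x}"
    using two_M_le_K
    by (intro derives_add sum_of_prods_mono[OF sum_of_prods_add[OF s1 s2]]) simp_all
  ultimately have "derives (4 * card U + 1 + 1 + 1 + 1) X
      (((({?e} \<union> {?x}) \<union> {(1 - mvar (Pos u)) * ?e}) \<union> {exactly U 0 * ?x}) \<union>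
        {(1 - mvar (Pos u)) * ?e + exactly U 0 * ?x})"
    by (rule derives_trans)
  moreover have "exactly (insert u U) 1 * mvar (Pos v) =
      (1 - mvar (Pos u)) * ?e + exactly U 0 * ?x"
    unfolding One_nat_def exactly_insert_Suc[OF insert.hyps] by (simp add: algebra_simps)
  ultimately show ?case
    by (elim derives_mono) (use insert.hyps in auto)
qed

text \<open>Adding \<open>v\<close> uses
  \<open>E_t(U + v) = (1 - x_v) E_t(U) + x_v E_(t-1)(U)\<close>. For \<open>t \<ge> 3\<close> both
  terms come from the induction hypothesis; for \<open>t = 2\<close> the second one is the preceding
  lemma.\<close>

lemma derives_at_most_one:
  assumes "finite U" "U \<subseteq> W" "0 \<in> X"
    and "\<And>u v. u \<in> U \<Longrightarrow> v \<in> U \<Longrightarrow> u \<noteq> v \<Longrightarrow> mvar (Pos u) * mvar (Pos v) \<in> Q"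
  shows "derives (7 * M * card U) X (exactly U ` {2..<M})"
  using assms
proof (induction U rule: finite_induct)
  case empty
  then show ?case
    by (intro derives_mono[OF derives_subset[of "{0}" X]]) (auto simp: exactly_empty)
next
  case (insert v U)
  let ?e = "exactly U 1 * mvar (Pos v) :: ('v fmc_var, 'a) mpoly"
    and ?E = "exactly U ` {2..<M} :: ('v fmc_var, 'a) mpoly set"
  have W: "v \<in> W" "U \<subseteq> W"
    using insert by auto
  have s1: "sum_of_prods W M ((1 - mvar (Pos v)) * exactly U a :: ('v fmc_var, 'a) mpoly)" for a
    using sum_of_prods_mult_W[OF sum_of_prods_not_mvar[of v] sum_of_prods_exactly_M[OF W(2)]] W insert.hyps
    by simp
  have s2: "sum_of_prods W M (mvar (Pos v) * exactly U a :: ('v fmc_var, 'a) mpoly)" for a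
    using sum_of_prods_mult_W[OF sum_of_prods_mvar[of v] sum_of_prods_exactly_M[OF W(2)]] W insert.hyps
    by simp
  have "derives (7 * M * card U) X ?E"
    using insert W by (intro insert.IH) auto
  moreover have "derives (4 * card U) (X \<union> ?E) {?e}"
    using insert by (intro derives_exactly_1_mult_mvar) auto
  ultimately have base: "derives (7 * M * card U + 4 * card U) X (?E \<union> {?e})"
    by (rule derives_trans)
  define Z where "Z = X \<union> (?E \<union> {?e})"
  have step: "derives 3 Z {exactly (insert v U) t}" if t: "t \<in> {2..<M}" for t
  proof -
    obtain a where a: "t = Suc a" "1 \<le> a" using t by (cases t) auto
    let ?p = "(1 - mvar (Pos v)) * exactly U t" and ?q = "mvar (Pos v) * exactly U a"
    have "derives 1 Z {?p}"
      by (rule derives_mult_disjoint[OF _ sum_of_prods_not_mvar sum_of_prods_exactly_M])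
        (use t W insert.hyps M_le_K in \<open>auto simp: Z_def\<close>)
    moreover have "derives 1 (Z \<union> {?p}) {?q}"
    \<comment> \<open>Weight 1 on \<open>U\<close> is possible, so \<open>E_1(U)\<close> is not
      among the available lines, but its product with \<open>x_v\<close> is.\<close>
    proof (cases "a = 1")
      case True
      then show ?thesis
        by (intro derives_mono[OF derives_subset[of "{?e}" Z]]) (auto simp: Z_def mult.commute)
    next
      case False
      show ?thesis
        by (rule derives_mult_disjoint[OF _ sum_of_prods_mvar sum_of_prods_exactly_M])
          (use False a t W insert.hyps M_le_K in \<open>auto simp: Z_def\<close>)
    qed
    ultimately have "derives (1 + 1) Z ({?p} \<union> {?q})"
      by (rule derives_trans)
    moreover have "derives 1 (Z \<union> ({?p} \<union> {?q})) {?p + ?q}"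
      using two_M_le_K
      by (intro derives_add sum_of_prods_mono[OF sum_of_prods_add[OF s1 s2]]) simp_all
    ultimately have "derives (1 + 1 + 1) Z (({?p} \<union> {?q}) \<union> {?p + ?q})"
      by (rule derives_trans)
    moreover have "exactly (insert v U) t = ?p + ?q"
      using exactly_insert_Suc[OF insert.hyps, of a] by (simp add: a)
    ultimately show ?thesis
      by (elim derives_mono) auto
  qed
  have "derives (card {2..<M} * 3) Z (\<Union>t\<in>{2..<M}. {exactly (insert v U) t})"
    using step by (intro derives_UN) auto
  with base have "derives (7 * M * card U + 4 * card U + card {2..<M} * 3) X
      ((?E \<union> {?e}) \<union> (\<Union>t\<in>{2..<M}. {exactly (insert v U) t}))"
    unfolding Z_def by (rule derives_trans)
  then show ?case
  proof (rule derives_mono)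
    have "card U < M"
      using card_mono[OF finite_W W(2)] by (simp add: M_eq)
    then show "7 * M * card U + 4 * card U + card {2..<M} * 3 \<le> 7 * M * card (insert v U)"
      using insert.hyps by (simp add: algebra_simps)
  qed auto
qed

text \<open>If each of \<open>k\<close> blocks has weight at most 1, the union has weight at most
  \<open>k\<close>. Adding a block treats at most \<open>M\<close> weights, with
  \<open>2 * M\<close> lines for each.\<close>

lemma derives_many:
  assumes "\<And>i. i < k \<Longrightarrow> B i \<subseteq> W" "disjoint_family_on B {..<k}" "0 \<in> X"
    and "\<And>i. i < k \<Longrightarrow> exactly (B i) ` {2..<M} \<subseteq> X"
  shows "derives (k * (M * (2 * M))) X (exactly (\<Union>i<k. B i) ` {k<..<M})"
  using assms
proof (induction k)
  case 0
  then show ?case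
    by (intro derives_mono[OF derives_subset[of "{0}" X]]) (auto simp: exactly_empty)
next
  case (Suc k)
  let ?U = "\<Union>i<k. B i"
  define Y where "Y = (exactly ?U ` {k<..<M} :: ('v fmc_var, 'a) mpoly set)"
  have IH: "derives (k * (M * (2 * M))) X Y"
    unfolding Y_def using Suc.prems
    by (intro Suc.IH) (auto simp: disjoint_family_on_def less_Suc_eq)
  have "derives (card {Suc k<..<M} * (2 * M)) (X \<union> Y) (\<Union>t\<in>{Suc k<..<M}. {exactly (?U \<union> B k) t})"
  proof (intro derives_UN derives_exactly_Un)
    fix t a assume t: "t \<in> {Suc k<..<M}" "a \<le> t"
    show "exactly ?U a \<in> X \<union> Y \<or> exactly (B k) (t - a) \<in> X \<union> Y"
    proof (cases "a > k")
      case True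
      then show ?thesis using t by (auto simp: Y_def)
    next
      case False
      \<comment> \<open>Here \<open>t \<ge> k + 2\<close> and \<open>a \<le> k\<close>, so the new
        block carries weight at least 2.\<close>
      then have "t - a \<in> {2..<M}" using t by auto
      then show ?thesis using Suc.prems(4)[of k] by auto
    qed
  next
    show "?U \<inter> B k = {}"
    proof -
      have "B i \<inter> B k = {}" if "i < k" for i
        using disjoint_family_onD[OF Suc.prems(2), of i k] that by simp
      then show ?thesis by blast
    qed
  qed (use Suc.prems(1,3) in \<open>auto simp: less_Suc_eq\<close>)
  with IH have "derives (k * (M * (2 * M)) + card {Suc k<..<M} * (2 * M)) X
      (Y \<union> (\<Union>t\<in>{Suc k<..<M}. {exactly (?U \<union> B k) t}))"
    by (rule derives_trans)
  then show ?case
    by (rule derives_mono) (auto simp: lessThan_Suc Un_commute)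
qed

text \<open>The dual count: if no block has weight 0, the union of \<open>k\<close> blocks has
  weight at least \<open>k\<close>.\<close>

lemma derives_few:
  assumes "\<And>i. i < k \<Longrightarrow> B i \<subseteq> W" "disjoint_family_on B {..<k}" "0 \<in> X" "k \<le> M"
    and "\<And>i. i < k \<Longrightarrow> exactly (B i) 0 \<in> X"
  shows "derives (k * (M * (2 * M))) X (exactly (\<Union>i<k. B i) ` {..<k})"
  using assms
proof (induction k)
  case 0
  then show ?case by (simp add: derives_subset)
next
  case (Suc k)
  let ?U = "\<Union>i<k. B i"
  define Y where "Y = (exactly ?U ` {..<k} :: ('v fmc_var, 'a) mpoly set)"
  have IH: "derives (k * (M * (2 * M))) X Y"
    unfolding Y_def using Suc.prems
    by (intro Suc.IH) (auto simp: disjoint_family_on_def less_Suc_eq)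
  have "derives (card {..<Suc k} * (2 * M)) (X \<union> Y) (\<Union>t\<in>{..<Suc k}. {exactly (?U \<union> B k) t})"
  proof (intro derives_UN derives_exactly_Un)
    fix t a assume t: "t \<in> {..<Suc k}" "a \<le> t"
    show "exactly ?U a \<in> X \<union> Y \<or> exactly (B k) (t - a) \<in> X \<union> Y"
    proof (cases "a < k")
      case True
      then show ?thesis by (auto simp: Y_def)
    next
      case False
      \<comment> \<open>From \<open>k \<le> a \<le> t \<le> k\<close> all weight lies on the old
        blocks, and the new block is left with weight 0.\<close>
      then have "t - a = 0" using t by auto
      then show ?thesis using Suc.prems(5)[of k] by auto
    qed
  next
    show "?U \<inter> B k = {}"
    proof -
      have "B i \<inter> B k = {}" if "i < k" for i
        using disjoint_family_onD[OF Suc.prems(2), of i k] that by simp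
      then show ?thesis by blast
    qed
  qed (use Suc.prems(1,3,4) in \<open>auto simp: less_Suc_eq\<close>)
  with IH have "derives (k * (M * (2 * M)) + card {..<Suc k} * (2 * M)) X
      (Y \<union> (\<Union>t\<in>{..<Suc k}. {exactly (?U \<union> B k) t}))"
    by (rule derives_trans)
  then show ?case
    by (rule derives_mono)
      (use mult_le_mono1[OF Suc.prems(4), of "2 * M"] in \<open>auto simp: lessThan_Suc Un_commute\<close>)
qed

lemma derives_one:
  assumes "0 \<in> X" "exactly W ` {..<M} \<subseteq> X"
  shows "derives M X {1}"
proof -
  have "derives (card {..card W}) X {\<Sum>t\<le>card W. exactly W t}"
  proof (rule derives_sum)
    show "sum_of_prods W M (exactly W t :: ('v fmc_var, 'a) mpoly)" for t
      by (simp add: sum_of_prods_exactly_M)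
    show "card {..card W} * M \<le> K"
      using M_M_le_K by (simp add: M_eq)
  qed (use assms in \<open>auto simp: M_eq\<close>)
  then show ?thesis
    unfolding sum_exactly[OF finite_W] by (simp add: M_eq)
qed

text \<open>Changing the sign of each factor gives
  \<open>E_0(U) = (-1)^|U| * \<Prod>(x_v - 1)\<close>, so the two lines are the axiom and its
  multiple by a constant.\<close>

lemma derives_pigeon:
  assumes "U \<subseteq> W" "(\<Prod>v\<in>U. mvar (Pos v) - 1) \<in> Q"
  shows "derives 2 X {exactly U 0}"
proof -
  let ?p = "\<Prod>v\<in>U. mvar (Pos v) - 1 :: ('v fmc_var, 'a) mpoly"
  have p: "?p = lin_prod U (\<lambda>_. (1, - 1))"
    by (simp add: lin_prod_def lin_factor_def mconst_minus)
  have "exactly U 0 = (\<Prod>v\<in>U. mconst (- 1) * (mvar (Pos v) - 1))"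
    using exactly_0[OF finite_subset_W[OF assms(1)]] by (simp add: mconst_minus)
  also have "\<dots> = mconst ((- 1) ^ card U) * ?p"
    by (simp add: prod.distrib mconst_power)
  finally have eq: "exactly U 0 = mconst ((- 1) ^ card U) * ?p" .
  have s: "sum_of_prods W 1 ?p"
    unfolding p by (rule sum_of_prods_W[OF sum_of_prods_lin_prod assms(1)]) simp
  have "1 \<le> K" using M_le_K M_ge_2 by simp
  with s have sK: "sum_of_prods W K ?p" by (rule sum_of_prods_mono)
  have "derives 1 X {?p}"
    by (rule derives_axiom[OF assms(2) sK])
  moreover have "derives 1 (X \<union> {?p}) {mconst ((- 1) ^ card U) * ?p}"
    by (rule derives_mult[OF _ sum_of_prods_scale[OF sK]]) simp_all
  ultimately have "derives (1 + 1) X ({?p} \<union> {mconst ((- 1) ^ card U) * ?p})"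
    by (rule derives_trans)
  then show ?thesis
    unfolding eq by (rule derives_mono) auto
qed

end

section \<open>The pigeonhole principle\<close>

lemma lin_eq_poly_var_eq: "lin_eq_poly (var_eq v b) = mvar (Pos v) - mconst b"
  by (simp add: lin_eq_poly_def var_eq_def)

lemma hole_axiom:
  assumes "1 \<le> i" "i < j" "j \<le> m" "k \<in> {1..n}"
  shows "mvar (Pos (i, k)) * mvar (Pos (j, k)) \<in> translate ` neg_PHP m n"
proof (rule image_eqI)
  show "[var_eq (i, k) 0, var_eq (j, k) 0] \<in> neg_PHP m n"
    unfolding neg_PHP_def using assms
    by (intro UnI2 CollectI exI[of _ i] exI[of _ j] exI[of _ k]) simp
qed (simp add: translate_def lin_eq_poly_var_eq)

lemma pigeon_axiom:
  assumes "i \<in> {1..m}"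
  shows "(\<Prod>v\<in>{i} \<times> {1..n}. mvar (Pos v) - 1) \<in> translate ` neg_PHP m n"
proof (rule image_eqI)
  show "map (\<lambda>j. var_eq (i, j) 1) [1..<Suc n] \<in> neg_PHP m n"
    unfolding neg_PHP_def using assms by (intro UnI1 CollectI exI[of _ i]) simp
  have "{i} \<times> {1..n} = Pair i ` {1..n}" by auto
  then have "(\<Prod>v\<in>{i} \<times> {1..n}. mvar (Pos v) - 1) = (\<Prod>j\<in>{1..n}. mvar (Pos (i, j)) - 1)"
    by (simp add: prod.reindex inj_on_def)
  also have "\<dots> = (\<Prod>j\<in>set [1..<Suc n]. mvar (Pos (i, j)) - 1)"
    by (rule prod.cong) auto
  also have "\<dots> = (\<Prod>j\<leftarrow>[1..<Suc n]. mvar (Pos (i, j)) - 1)"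
    by (rule prod.distinct_set_conv_list) simp
  also have "\<dots> = translate (map (\<lambda>j. var_eq (i, j) 1) [1..<Suc n])"
    by (simp add: translate_def lin_eq_poly_var_eq o_def)
  finally show "(\<Prod>v\<in>{i} \<times> {1..n}. mvar (Pos v) - 1) =
    translate (map (\<lambda>j. var_eq (i, j) 1) [1..<Suc n])" .
qed

lemma php_refutation_exists:
  assumes "n < m" "0 < n"
  shows "\<exists>\<pi> :: ((nat \<times> nat) fmc_var, 'a::field_char_0) aformula list.
    fmc_refutation (php_vars m n) (translate ` neg_PHP m n) \<pi> \<and>
    fmc_depth_at_most 3 \<pi> \<and> fmc_size \<pi> \<le> 48 * (n + 1) ^ 14"
proof -
  \<comment> \<open>Restricting to \<open>n + 1\<close> pigeons makes the size bound independent of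
    \<open>m\<close>.\<close>
  define W where "W = php_vars (n + 1) n"
  define M where "M = card W + 1"
  define K where "K = M * (M * M)"
  define Q where "Q = (translate ` neg_PHP m n :: ((nat \<times> nat) fmc_var, 'a) mpoly set)"
  have card_W: "card W = (n + 1) * n"
    by (simp add: W_def php_vars_def)
  interpret count_lines "php_vars m n" W Q K M
  proof
    show "W \<noteq> {}" "finite W" "W \<subseteq> php_vars m n"
      using assms by (auto simp: W_def php_vars_def)
  qed (simp_all add: M_def K_def)
  \<comment> \<open>Columns are holes and rows are pigeons. The shift by \<open>Suc\<close> matches
    blocks counted from 0 with holes and pigeons counted from 1.\<close>
  define col where "col k = {1..n + 1} \<times> {Suc k}" for k
  define row where "row i = {Suc i} \<times> {1..n}" for i
  have col: "col k \<subseteq> W" if "k < n" for k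
    using that by (auto simp: col_def W_def php_vars_def)
  have row: "row i \<subseteq> W" if "i < n + 1" for i
    using that by (auto simp: row_def W_def php_vars_def)
  have hole: "mvar (Pos u) * mvar (Pos v) \<in> Q"
    if k: "k < n" and uv: "u \<in> col k" "v \<in> col k" "u \<noteq> v" for u v k
  proof -
    obtain i j where ij: "u = (i, Suc k)" "v = (j, Suc k)" "i \<in> {1..n + 1}" "j \<in> {1..n + 1}"
      using uv unfolding col_def by blast
    then consider "i < j" | "j < i" using uv(3) by fastforce
    then show ?thesis
    proof cases
      case 1
      show ?thesis
        unfolding Q_def ij(1,2) by (rule hole_axiom) (use 1 ij(3,4) assms k in auto)
    next
      \<comment> \<open>The axioms put the smaller pigeon first, so the two factors are
        swapped.\<close>
      case 2
      show ?thesis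
        unfolding Q_def ij(1,2) mult.commute[of "mvar (Pos (i, Suc k))"]
        by (rule hole_axiom) (use 2 ij(3,4) assms k in auto)
    qed
  qed
  have UN_col: "(\<Union>k<n. col k) = W"
  proof -
    have "(i, j) \<in> (\<Union>k<n. col k)" if "(i, j) \<in> W" for i j
      using that by (auto simp: W_def php_vars_def col_def intro!: bexI[of _ "j - 1"])
    then show ?thesis using col by auto
  qed
  have UN_row: "(\<Union>i<n + 1. row i) = W"
  proof -
    have "(i, j) \<in> (\<Union>i<n + 1. row i)" if "(i, j) \<in> W" for i j
      using that by (auto simp: W_def php_vars_def row_def intro!: bexI[of _ "i - 1"])
    then show ?thesis using row by auto
  qed
  have n_le_M: "n + 1 \<le> M"
    using assms(2) by (simp add: M_def card_W)

  let ?h = "mvar (Pos (1, 1)) * mvar (Pos (2, 1)) :: ((nat \<times> nat) fmc_var, 'a) mpoly"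
  have "?h \<in> Q"
    unfolding Q_def using assms by (intro hole_axiom) auto
  moreover have "sum_of_prods W (1 * 1) ?h"
    using assms by (intro sum_of_prods_mult_W[OF sum_of_prods_mvar sum_of_prods_mvar])
      (auto simp: W_def php_vars_def)
  then have "sum_of_prods W K ?h"
    by (rule sum_of_prods_mono) (use M_le_K M_ge_2 in simp)
  ultimately have "derives 1 {} {?h}"
    by (rule derives_axiom)
  moreover have "derives 1 ({} \<union> {?h}) {0 * ?h}"
    by (rule derives_mult) (simp_all add: sum_of_prods.zero)
  ultimately have "derives (1 + 1) {} ({?h} \<union> {0 * ?h})"
    by (rule derives_trans)
  then have zero: "derives 2 {} {0}"
    by (rule derives_mono) auto
  \<comment> \<open>The holes: each of the \<open>n\<close> columns has weight at most 1, which
    excludes total weights above \<open>n\<close>.\<close>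
  define X1 where "X1 = (\<Union>k\<in>{..<n}. exactly (col k) ` {2..<M} :: ((nat \<times> nat) fmc_var, 'a) mpoly set)"
  have "derives (card {..<n} * (7 * M * M)) ({} \<union> {0}) X1"
    unfolding X1_def
  proof (rule derives_UN)
    fix k assume k: "k \<in> {..<n}"
    have "derives (7 * M * card (col k)) {0} (exactly (col k) ` {2..<M})"
      using k col hole by (intro derives_at_most_one finite_subset_W) auto
    moreover have "card (col k) \<le> M"
      using n_le_M by (simp add: col_def)
    ultimately show "derives (7 * M * M) ({} \<union> {0}) (exactly (col k) ` {2..<M})"
      by (elim derives_mono) auto
  qed simp
  with zero have *: "derives (2 + card {..<n} * (7 * M * M)) {} ({0} \<union> X1)"
    by (rule derives_trans)
  have "derives (n * (M * (2 * M))) ({} \<union> ({0} \<union> X1)) (exactly (\<Union>k<n. col k) ` {n<..<M})"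
    using col by (intro derives_many) (auto simp: X1_def disjoint_family_on_def col_def)
  with * have "derives (2 + card {..<n} * (7 * M * M) + n * (M * (2 * M))) {}
      (({0} \<union> X1) \<union> exactly W ` {n<..<M})"
    unfolding UN_col by (rule derives_trans)
  then have many: "derives (2 + n * (7 * M * M) + n * (M * (2 * M))) {}
      ({0} \<union> exactly W ` {n<..<M})"
    by (rule derives_mono) auto
  \<comment> \<open>The pigeons: each of the \<open>n + 1\<close> rows has positive weight, which
    excludes total weights up to \<open>n\<close>.\<close>
  define X2 where "X2 = (\<Union>i\<in>{..<n + 1}. {exactly (row i) 0 :: ((nat \<times> nat) fmc_var, 'a) mpoly})"
  have "derives (card {..<n + 1} * 2) {} X2"
    unfolding X2_def
  proof (rule derives_UN)
    fix i assume i: "i \<in> {..<n + 1}"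
    have "(\<Prod>v\<in>row i. mvar (Pos v) - 1) \<in> Q"
      unfolding Q_def row_def using i assms by (intro pigeon_axiom) auto
    with i row show "derives 2 {} {exactly (row i) 0}"
      by (intro derives_pigeon) auto
  qed simp
  then have "derives ((n + 1) * 2) {0} X2"
    by (rule derives_mono) auto
  moreover have "derives ((n + 1) * (M * (2 * M))) ({0} \<union> X2) (exactly (\<Union>i<n + 1. row i) ` {..<n + 1})"
    using row n_le_M by (intro derives_few) (auto simp: X2_def disjoint_family_on_def row_def)
  ultimately have "derives ((n + 1) * 2 + (n + 1) * (M * (2 * M))) {0} (X2 \<union> exactly W ` {..<n + 1})"
    unfolding UN_row by (rule derives_trans)
  then have "derives ((n + 1) * 2 + (n + 1) * (M * (2 * M))) ({} \<union> ({0} \<union> exactly W ` {n<..<M}))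
      (exactly W ` {..<n + 1})"
    by (rule derives_mono) auto
  with many have "derives (2 + n * (7 * M * M) + n * (M * (2 * M)) +
      ((n + 1) * 2 + (n + 1) * (M * (2 * M)))) {}
      (({0} \<union> exactly W ` {n<..<M}) \<union> exactly W ` {..<n + 1})"
    by (rule derives_trans)
  moreover have "derives M ({} \<union> (({0} \<union> exactly W ` {n<..<M}) \<union> exactly W ` {..<n + 1})) {1}"
  proof (rule derives_one)
    have "{..<M} \<subseteq> {n<..<M} \<union> {..<n + 1}" by auto
    then show "exactly W ` {..<M} \<subseteq> {} \<union> (({0} \<union> exactly W ` {n<..<M}) \<union> exactly W ` {..<n + 1})"
      by blast
  qed simp
  ultimately have "derives (2 + n * (7 * M * M) + n * (M * (2 * M)) +
      ((n + 1) * 2 + (n + 1) * (M * (2 * M))) + M) {}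
      ((({0} \<union> exactly W ` {n<..<M}) \<union> exactly W ` {..<n + 1}) \<union> {1})"
    by (rule derives_trans)
  \<comment> \<open>The terms with \<open>M * M\<close> contribute at most
    \<open>(7 + 2 + 2) * K\<close>, and the others at most \<open>4 * M \<le> 2 * K\<close>, so 16
    is a generous constant.\<close>
  moreover have "2 + n * (7 * M * M) + n * (M * (2 * M)) +
      ((n + 1) * 2 + (n + 1) * (M * (2 * M))) + M \<le> 16 * K"
  proof -
    have "n * (M * M) \<le> K" "(n + 1) * (M * M) \<le> K"
      unfolding K_def using n_le_M by (intro mult_le_mono1; simp)+
    then show ?thesis
      using two_M_le_K M_ge_2 n_le_M by (simp add: algebra_simps)
  qed
  ultimately have "derives (16 * K) {} {1}"
    by (elim derives_mono) auto
  then obtain \<pi> where \<pi>: "fmc_refutation (php_vars m n) Q \<pi>" "fmc_depth_at_most 3 \<pi>"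
    "fmc_size \<pi> \<le> 16 * K * (1 + K * (1 + 3 * card W))"
    using refutation_of_derives by blast
  have "1 + K * (1 + 3 * card W) \<le> K * (3 * M)"
    using M_le_K M_ge_2 by (simp add: M_def algebra_simps)
  then have "16 * K * (1 + K * (1 + 3 * card W)) \<le> 16 * K * (K * (3 * M))"
    by (rule mult_le_mono2)
  also have "\<dots> = 48 * M ^ 7"
    by (simp add: K_def power_numeral_reduce)
  \<comment> \<open>Here \<open>M = (n + 1) * n + 1\<close> is at most the square of
    \<open>n + 1\<close>.\<close>
  also have "\<dots> \<le> 48 * ((n + 1)\<^sup>2) ^ 7"
    by (intro mult_le_mono2 power_mono) (simp_all add: M_def card_W power2_eq_square)
  also have "\<dots> = 48 * (n + 1) ^ 14"
    by (simp flip: power_mult)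
  finally show ?thesis
    using \<pi> unfolding Q_def by (meson order.trans)
qed

theorem theorem9p16:
  shows "\<exists>b :: nat poly. \<forall>m n :: nat. m > n \<longrightarrow>
    (\<exists>\<pi> :: ((nat \<times> nat) fmc_var, 'a::field_char_0) aformula list.
       fmc_refutation (php_vars m n) (translate ` neg_PHP m n) \<pi> \<and>
       fmc_depth_at_most 3 \<pi> \<and>
       fmc_size \<pi> \<le> poly b n)"
proof (intro exI[of _ "smult 48 ([:1, 1:] ^ 14)"] allI impI)
  fix m n :: nat assume "n < m"
  show "\<exists>\<pi> :: ((nat \<times> nat) fmc_var, 'a) aformula list.
       fmc_refutation (php_vars m n) (translate ` neg_PHP m n) \<pi> \<and>
       fmc_depth_at_most 3 \<pi> \<and> fmc_size \<pi> \<le> poly (smult 48 ([:1, 1:] ^ 14)) n"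
  \<comment> \<open>The general construction works over a nonempty set of variables, hence with at
    least one hole.\<close>
  proof (cases "n = 0")
    case True
    \<comment> \<open>Without holes, a pigeon axiom is the empty product \<open>1\<close>.\<close>
    have "map (\<lambda>j. var_eq (1, j) 1) [1..<Suc n] \<in> (neg_PHP m n :: (nat \<times> nat, 'a) lin_disj set)"
      unfolding neg_PHP_def using \<open>n < m\<close> by (intro UnI1 CollectI exI[of _ 1]) simp
    then have "translate [] \<in> (translate ` neg_PHP m n :: ((nat \<times> nat) fmc_var, 'a) mpoly set)"
      using True by auto
    then have "fmc_refutation (php_vars m n) (translate ` neg_PHP m n) [ConstLeaf (1::'a)]"
      by (simp add: fmc_refutation_def fmc_proof_def fmc_step_def translate_def)
    then show ?thesis
      using True by (intro exI[of _ "[ConstLeaf 1]"]) (simp add: fmc_depth_at_most_def fmc_size_def)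
  next
    case False
    then show ?thesis
      using php_refutation_exists[OF \<open>n < m\<close>] by (simp add: poly_power add.commute)
  qed
qed

end
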